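(* Let $a,b,q$ be nonnegative integers with $a<b$, $2\le b$, $1\le q\le b$, with $q$ even, let $p>0$ be a real number, and let $$f(x,y)=x^a y^b+x^a y^{b-q}e^{-1/|x|^p}.$$ Let $U$ be an open neighborhood of the origin in $\mathbb{R}^2$ and let $\varphi$ be a real-valued $C^\infty$ function with compact support contained in $U$ such that $\varphi(0,0)>0$ and $\varphi(x,y)\ge0$ on $U$. Then $Z_f(\varphi)$ cannot be meromorphically continued to any open neighborhood of $s=-1/b$ in $\mathbb{C}$. In other words, the singularity of $Z_f(\varphi)(s)$ at $s=-1/b$ is different from a pole.
   Context: The function $e^{-1/|x|^p}$ is regarded as a $C^\infty$ function on $\mathbb{R}$ by giving it the value $0$ at $x=0$. Zeroth powers $x^0,y^0$ are the constant $1$. The local zeta function is $$Z_f(\varphi)(s)=\int_{\mathbb{R}^2}|f(x,y)|^s\varphi(x,y)\,dx\,dy ,$$ which converges and is holomorphic on the half-plane $\mathrm{Re}(s)>-1/b$. That $Z_f(\varphi)$ can be meromorphically continued to an open neighborhood $V$ of $-1/b$ means that there is a meromorphic function on $V\cup\{s\in\mathbb{C}:\mathrm{Re}(s)>-1/b\}$ which coincides with $Z_f(\varphi)$ on $\mathrm{Re}(s)>-1/b$. *)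

theory Defs
  imports "HOL-Analysis.Analysis" "HOL-Complex_Analysis.Complex_Analysis"
begin

text \<open>Differentiability of class C^k, iterated over directional derivatives. Between
  finite-dimensional spaces, where \<open>S\<close> is open, this is the usual notion: all partial
  derivatives up to order \<open>k\<close> exist and are continuous.\<close>

primrec Ck_on :: "nat \<Rightarrow> 'a::real_normed_vector set \<Rightarrow> ('a \<Rightarrow> 'b::real_normed_vector) \<Rightarrow> bool" where
  "Ck_on 0 S f \<longleftrightarrow> continuous_on S f"
| "Ck_on (Suc k) S f \<longleftrightarrow>
     (\<forall>x\<in>S. f differentiable (at x)) \<and>
     (\<forall>v. Ck_on k S (\<lambda>x. frechet_derivative f (at x) v))"

definition smooth_on :: "'a::real_normed_vector set \<Rightarrow> ('a \<Rightarrow> 'b::real_normed_vector) \<Rightarrow> bool" where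
  "smooth_on S f \<longleftrightarrow> (\<forall>k. Ck_on k S f)"

text \<open>The value at 0 is set explicitly, since \<open>1 / 0 = 0\<close> would make the exponential 1 there.\<close>

definition flat_exp :: "real \<Rightarrow> real \<Rightarrow> real" where
  "flat_exp p x = (if x = 0 then 0 else exp (- 1 / (\<bar>x\<bar> powr p)))"

definition phase :: "nat \<Rightarrow> nat \<Rightarrow> nat \<Rightarrow> real \<Rightarrow> real \<times> real \<Rightarrow> real" where
  "phase a b q p = (\<lambda>(x, y). x ^ a * y ^ b + x ^ a * y ^ (b - q) * flat_exp p x)"

text \<open>On the zero set of \<open>f\<close> the integrand is 0 because \<open>0 powr s = 0\<close>; the functions
  \<open>f\<close> considered here vanish only on a null set, so this convention is immaterial.\<close>

definition local_zeta :: "(real \<times> real \<Rightarrow> real) \<Rightarrow> (real \<times> real \<Rightarrow> real) \<Rightarrow> complex \<Rightarrow> complex" where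
  "local_zeta f \<phi> s = (LINT z|lborel. complex_of_real \<bar>f z\<bar> powr s * complex_of_real (\<phi> z))"

definition meromorphically_continuable ::
    "(complex \<Rightarrow> complex) \<Rightarrow> complex set \<Rightarrow> complex set \<Rightarrow> bool" where
  "meromorphically_continuable F H V \<longleftrightarrow>
     (\<exists>g. g meromorphic_on (V \<union> H) \<and> (\<forall>s\<in>H. g s = F s))"

end

theory Submission
  imports Defs
begin

text \<open>For fixed \<open>x \<noteq> 0\<close> the flat term keeps the integral over \<open>y\<close> bounded as \<open>s\<close> tends to
  \<open>- 1 / b\<close>, and small \<open>x\<close> contribute little. Hence \<open>(s + 1 / b) Z(s) \<longlonglongrightarrow> 0\<close> along the real
  axis, a meromorphic continuation would be holomorphic at \<open>- 1 / b\<close>, and all real derivatives of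
  \<open>Z\<close> would stay bounded there. But formally the \<open>k\<close>-th derivative at \<open>- 1 / b\<close> is
  the integral of \<open>\<bar>f\<bar> powr (- 1 / b) * (ln \<bar>f\<bar>) ^ k * \<phi>\<close>. On the region where \<open>y ^ q < flat_exp p x\<close>,
  \<open>\<bar>ln \<bar>f\<bar>\<bar>\<close> is at least of order \<open>1 / \<bar>x\<bar> powr p\<close>, while integrating \<open>\<bar>f\<bar> powr (- 1 / b)\<close> over \<open>y\<close>
  contributes at least a positive constant; so the integral diverges like that of \<open>\<bar>x\<bar> powr (- p k)\<close>
  once \<open>k\<close> is large. Finite differences replace derivatives, so that no differentiation
  under the integral is needed.\<close>

section \<open>Finite differences along the real line\<close>

primrec fdiff :: "nat \<Rightarrow> real \<Rightarrow> (real \<Rightarrow> real) \<Rightarrow> real \<Rightarrow> real" where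
  "fdiff 0 h u t = u t"
| "fdiff (Suc k) h u t = fdiff k h u (t + h) - fdiff k h u t"

text \<open>Shifting the exponent by \<open>h\<close> multiplies by \<open>x powr h\<close>, so each
  difference contributes one factor \<open>x powr h - 1\<close>. For \<open>x > 0\<close>, division
  by \<open>h ^ k\<close> makes these factors approximate \<open>ln x ^ k\<close>.\<close>

lemma fdiff_powr:
  fixes x h t :: real
  shows "fdiff k h (\<lambda>s. x powr s) t = x powr t * (x powr h - 1) ^ k"
  by (induction k arbitrary: t) (simp_all add: powr_add algebra_simps)

lemma fdiff_cong:
  assumes "\<And>j. j \<le> k \<Longrightarrow> u (t + real j * h) = v (t + real j * h)"
  shows "fdiff k h u t = fdiff k h v t"
  using assms
proof (induction k arbitrary: t)
  case 0
  show ?case using 0[of 0] by simp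
next
  case (Suc k)
  have "fdiff k h u (t + h) = fdiff k h v (t + h)"
  proof (rule Suc.IH)
    fix j assume "j \<le> k"
    then show "u (t + h + real j * h) = v (t + h + real j * h)"
      using Suc.prems[of "Suc j"] by (simp add: algebra_simps)
  qed
  moreover have "fdiff k h u t = fdiff k h v t"
    by (rule Suc.IH) (use Suc.prems in auto)
  ultimately show ?case by simp
qed

lemma fdiff_mult_right: "fdiff k h (\<lambda>s. u s * c) t = fdiff k h u t * c"
  by (induction k arbitrary: t) (simp_all add: algebra_simps)

lemma fdiff_DERIV:
  assumes "\<And>t. t \<in> {a..b} \<Longrightarrow> (u has_real_derivative v t) (at t)"
    and "0 \<le> h" "a \<le> t" "t + real k * h \<le> b"
  shows "(fdiff k h u has_real_derivative fdiff k h v t) (at t)"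
  using assms(3,4)
proof (induction k arbitrary: t)
  case 0
  then show ?case using assms(1)[of t] by simp
next
  case (Suc k)
  have t: "a \<le> t + h" "t + h + real k * h \<le> b"
    using Suc.prems assms(2) by (auto simp: algebra_simps)
  have t': "t + real k * h \<le> b"
    using Suc.prems assms(2) by (auto simp: algebra_simps)
  have "((\<lambda>t. fdiff k h u (t + h)) has_real_derivative fdiff k h v (t + h)) (at t)"
    using Suc.IH[OF t] by (simp add: DERIV_shift)
  from DERIV_diff[OF this Suc.IH[OF Suc.prems(1) t']]
  show ?case by (simp add: fun_eq_iff)
qed

text \<open>Iterated mean value theorem: each difference is traded for one derivative and one factor
  \<open>h\<close>. The family \<open>u\<close> lists the successive derivatives.\<close>

lemma fdiff_bound:
  assumes deriv: "\<And>m t. t \<in> {a..b} \<Longrightarrow> (u m has_real_derivative u (Suc m) t) (at t)"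
    and bd: "\<And>t. t \<in> {a..b} \<Longrightarrow> \<bar>u (m + k) t\<bar> \<le> B"
    and "0 \<le> h" "a \<le> t" "t + real k * h \<le> b"
  shows "\<bar>fdiff k h (u m) t\<bar> \<le> B * h ^ k"
  using bd assms(4,5)
proof (induction k arbitrary: m t)
  case 0
  then show ?case by simp
next
  case (Suc k)
  have le: "t + h + real k * h \<le> b"
    using Suc.prems by (auto simp: algebra_simps)
  have IH: "\<bar>fdiff k h (u (Suc m)) s\<bar> \<le> B * h ^ k" if "t \<le> s" "s \<le> t + h" for s
    by (rule Suc.IH) (use Suc.prems le that in auto)
  show ?case
  proof (cases "h = 0")
    case True
    then show ?thesis by simp
  next
    case False
    then have "t < t + h" using assms(3) by simp
    then obtain z where z: "t < z" "z < t + h"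
      "fdiff k h (u m) (t + h) - fdiff k h (u m) t = (t + h - t) * fdiff k h (u (Suc m)) z"
      using MVT2[of t "t + h" "fdiff k h (u m)" "fdiff k h (u (Suc m))"]
        fdiff_DERIV[of a b "u m" "u (Suc m)" h _ k] deriv assms(3) Suc.prems(2) le
      by (smt (verit))
    have "\<bar>fdiff (Suc k) h (u m) t\<bar> = h * \<bar>fdiff k h (u (Suc m)) z\<bar>"
      using z(3) assms(3) by (simp add: abs_mult)
    also have "\<dots> \<le> h * (B * h ^ k)"
      using IH[of z] z assms(3) by (intro mult_left_mono) auto
    finally show ?thesis by (simp add: mult_ac)
  qed
qed

text \<open>The \<open>k\<close>-th derivative is bounded on the compact segment from
  \<open>c\<close> to \<open>c + r/2\<close>, hence \<open>B\<close> does not depend on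
  \<open>h\<close>. The differences start at \<open>c + h\<close>, not at \<open>c\<close>, because
  they will be compared with a function known only to the right of \<open>c\<close>.\<close>

lemma holomorphic_fdiff_bound:
  fixes G :: "complex \<Rightarrow> complex" and c r :: real
  assumes G: "G holomorphic_on ball (of_real c) r" and "r > 0"
  obtains B where "\<And>h. 0 < h \<Longrightarrow> (real k + 1) * h \<le> r / 2 \<Longrightarrow>
    \<bar>fdiff k h (\<lambda>s. Re (G (of_real s))) (c + h)\<bar> \<le> B * h ^ k"
proof -
  define u where "u = (\<lambda>m s. Re ((deriv ^^ m) G (of_real s)))"
  have in_ball: "of_real s \<in> ball (complex_of_real c) r" if "s \<in> {c..c + r/2}" for s
    using that \<open>r > 0\<close> by (auto simp: dist_real_def simp flip: dist_of_real[where 'a=complex])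
  have hol: "(deriv ^^ m) G holomorphic_on ball (of_real c) r" for m
    using G by (intro holomorphic_higher_deriv) auto
  have deriv: "(u m has_real_derivative u (Suc m) s) (at s)" if "s \<in> {c..c + r/2}" for m s
  proof -
    have "((deriv ^^ m) G has_field_derivative (deriv ^^ Suc m) G (of_real s)) (at (of_real s))"
      using holomorphic_derivI[OF hol[of m] _ in_ball[OF that]] by simp
    then have "((\<lambda>s. (deriv ^^ m) G (of_real s)) has_vector_derivative (deriv ^^ Suc m) G (of_real s)) (at s)"
      using field_differentiable_derivI has_vector_derivative_real_field by blast
    then have "((\<lambda>s. Re ((deriv ^^ m) G (of_real s))) has_vector_derivative
        Re ((deriv ^^ Suc m) G (of_real s))) (at s)"
      by (rule bounded_linear.has_vector_derivative[OF bounded_linear_Re])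
    then show ?thesis
      by (simp add: u_def has_real_derivative_iff_has_vector_derivative)
  qed
  have "continuous_on {c..c + r/2} (u k)"
    using deriv by (meson DERIV_isCont continuous_at_imp_continuous_on)
  then have "compact (u k ` {c..c + r/2})"
    by (intro compact_continuous_image) auto
  then obtain B where B: "\<And>s. s \<in> {c..c + r/2} \<Longrightarrow> \<bar>u k s\<bar> \<le> B"
    using compact_imp_bounded bounded_iff by (metis imageI real_norm_def)
  show thesis
  proof
    fix h :: real assume h: "0 < h" "(real k + 1) * h \<le> r / 2"
    have "\<bar>fdiff k h (u 0) (c + h)\<bar> \<le> B * h ^ k"
      by (rule fdiff_bound[where a = c and b = "c + r/2"])
        (use deriv B h in \<open>auto simp: algebra_simps\<close>)
    then show "\<bar>fdiff k h (\<lambda>s. Re (G (of_real s))) (c + h)\<bar> \<le> B * h ^ k"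
      by (simp add: u_def)
  qed
qed

section \<open>Removing a singularity by a limit along a ray\<close>

text \<open>Meromorphy rules out an essential singularity, so one ray suffices: at a pole of order
  \<open>n + 1\<close> the product \<open>(w - z) ^ (n + 1) * g w\<close> has a nonzero limit from
  every direction, whereas on the ray it tends to 0.\<close>

lemma meromorphic_removable_along_ray:
  fixes g :: "complex \<Rightarrow> complex" and c :: real
  assumes mero: "g meromorphic_on {of_real c}"
    and lim: "((\<lambda>s. of_real (s - c) * g (of_real s)) \<longlongrightarrow> 0) (at_right c)"
  obtains G r where "r > 0" "G holomorphic_on ball (of_real c) r"
    "\<And>s. s \<in> ball (of_real c) r - {of_real c} \<Longrightarrow> G s = g s"
proof -
  define z where "z = complex_of_real c"
  have iso: "isolated_singularity_at g z" and ness: "not_essential g z"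
    using mero unfolding z_def
    by (auto intro: meromorphic_on_isolated_singularity meromorphic_on_not_essential)
  have ray: "filterlim complex_of_real (at z) (at_right c)"
    unfolding filterlim_at z_def
    by (auto intro!: tendsto_eq_intros simp: eventually_at_filter)
  have "\<not> is_pole g z"
  proof
    assume pole: "is_pole g z"
    have "\<exists>\<^sub>F w in at z. g w \<noteq> 0"
      using non_zero_neighbour_pole[OF pole] by (simp add: eventually_frequently)
    from zorder_exist[OF iso ness this] obtain r where r: "r > 0" and
      nz: "zor_poly g z z \<noteq> 0" and hol: "zor_poly g z holomorphic_on cball z r" and
      eq: "\<And>w. w \<in> cball z r - {z} \<Longrightarrow> g w = zor_poly g z w * (w - z) powi zorder g z"
      by blast
    \<comment> \<open>Writing the order as \<open>Suc n\<close> leaves one factor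
      \<open>w - z\<close> to pair with \<open>g w\<close>, which is the product controlled by
      \<open>lim\<close>.\<close>
    obtain n where n: "zorder g z = - int (Suc n)"
      using isolated_pole_imp_neg_zorder[OF iso pole]
      by (metis neg_int_cases zero_less_imp_eq_int not_gr_zero gr0_implies_Suc)
    have near: "\<forall>\<^sub>F w in at z. w \<in> cball z r - {z}"
      using r by (auto simp: eventually_at intro!: exI[of _ r] simp: dist_commute)
    have "isCont (zor_poly g z) z"
      using hol r holomorphic_on_imp_continuous_on
      by (metis centre_in_ball continuous_on_interior interior_cball)
    then have zl: "(zor_poly g z \<longlongrightarrow> zor_poly g z z) (at z)"
      by (simp add: isCont_def)
    have "((\<lambda>w. (w - z) ^ n * ((w - z) * g w)) \<longlongrightarrow> zor_poly g z z) (at z)"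
    proof (rule Lim_transform_eventually[OF zl])
      show "\<forall>\<^sub>F w in at z. zor_poly g z w = (w - z) ^ n * ((w - z) * g w)"
        using near
      proof eventually_elim
        case (elim w)
        then show ?case
          using eq[of w] unfolding n power_int_minus power_int_of_nat by (simp add: field_simps)
      qed
    qed
    from filterlim_compose[OF this ray]
    have 1: "((\<lambda>s. (of_real s - z) ^ n * ((of_real s - z) * g (of_real s))) \<longlongrightarrow> zor_poly g z z) (at_right c)" .
    have "((\<lambda>s. (of_real s - z) ^ n * ((of_real s - z) * g (of_real s))) \<longlongrightarrow> (z - z) ^ n * 0) (at_right c)"
      using lim by (intro tendsto_intros) (auto simp: z_def intro!: tendsto_of_real tendsto_ident_at)
    with 1 have "zor_poly g z z = 0"
      using tendsto_unique trivial_limit_at_right_real by fastforce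
    with nz show False by simp
  qed
  then obtain l where l: "g \<midarrow>z\<rightarrow> l"
    using ness by (auto simp: not_essential_def)
  have "remove_sings g analytic_on {z}"
    by (rule remove_sings_analytic_at[OF iso l])
  then obtain r1 where r1: "r1 > 0" "remove_sings g holomorphic_on ball z r1"
    by (auto simp: analytic_on_def)
  obtain r2 where r2: "r2 > 0" "\<And>w. w \<noteq> z \<Longrightarrow> dist w z < r2 \<Longrightarrow> remove_sings g w = g w"
    using eventually_remove_sings_eq_at[OF iso] by (auto simp: eventually_at)
  show thesis
    by (rule that[of "min r1 r2" "remove_sings g"])
      (use r1 r2 in \<open>auto simp: z_def dist_commute intro: holomorphic_on_subset\<close>)
qed

section \<open>Auxiliary integrals and the flat exponential\<close>

lemma nn_integral_abs_powr:
  fixes s r :: real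
  assumes "-1 < s" "0 \<le> r"
  shows "(\<integral>\<^sup>+x. ennreal (indicator {-r..r} x * \<bar>x\<bar> powr s) \<partial>lborel) = ennreal (2 * r powr (s+1) / (s+1))"
proof -
  have pos: "((\<lambda>x. x powr s) has_integral (r powr (s+1) / (s+1))) {0..r}"
    using assms by (rule has_integral_powr_from_0)
  then have p: "((\<lambda>x. \<bar>x\<bar> powr s) has_integral (r powr (s+1) / (s+1))) {0..r}"
    by (rule has_integral_eq[rotated]) auto
  have n: "((\<lambda>x. \<bar>x\<bar> powr s) has_integral (r powr (s+1) / (s+1))) {-r..0}"
    using has_integral_reflect_real[THEN iffD2, OF p] by simp
  have "((\<lambda>x. \<bar>x\<bar> powr s) has_integral (r powr (s+1) / (s+1) + r powr (s+1) / (s+1))) {-r..r}"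
    by (rule has_integral_combine[OF _ _ n p]) (use assms in auto)
  from nn_integral_has_integral_lebesgue[OF _ this] show ?thesis
    by (simp add: field_simps)
qed

lemma flat_exp_pos: "x \<noteq> 0 \<Longrightarrow> flat_exp p x > 0"
  by (simp add: flat_exp_def)

lemma flat_exp_nonneg: "flat_exp p x \<ge> 0"
  by (simp add: flat_exp_def)

lemma flat_exp_mono:
  assumes "0 < \<delta>" "\<delta> \<le> \<bar>x\<bar>" "0 \<le> p"
  shows "flat_exp p \<delta> \<le> flat_exp p x"
  using assms by (auto simp: flat_exp_def intro!: divide_left_mono powr_mono2)

lemma flat_exp_le_1: "flat_exp p x \<le> 1"
  by (simp add: flat_exp_def)

lemma measurable_flat_exp [measurable]: "flat_exp p \<in> borel_measurable borel"
  unfolding flat_exp_def[abs_def] by measurable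

lemma measurable_phase [measurable]: "phase a b q p \<in> borel_measurable borel"
  unfolding phase_def borel_prod[symmetric] by measurable

text \<open>A difference is a finite linear combination of values, so it commutes with the integral.
  This stands in for differentiation under the integral sign.\<close>

lemma integral_fdiff:
  assumes "\<And>j. j \<le> k \<Longrightarrow> integrable M (w (t + real j * h))"
  shows "integrable M (\<lambda>z. fdiff k h (\<lambda>s. w s z) t) \<and>
    (\<integral>z. fdiff k h (\<lambda>s. w s z) t \<partial>M) = fdiff k h (\<lambda>s. \<integral>z. w s z \<partial>M) t"
  using assms
proof (induction k arbitrary: t)
  case 0
  show ?case using 0[of 0] by simp
next
  case (Suc k)
  have "integrable M (w (t + h + real j * h))" if "j \<le> k" for j
    using Suc.prems[of "Suc j"] that by (simp add: algebra_simps)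
  note Suc.IH[OF this]
  moreover have "integrable M (w (t + real j * h))" if "j \<le> k" for j
    using Suc.prems[of j] that by simp
  note Suc.IH[OF this]
  ultimately show ?case by simp
qed

text \<open>Already the interval from \<open>\<eta>\<close> to \<open>2 * \<eta>\<close> contributes
  at least \<open>c / (4 * \<eta>)\<close>, which is unbounded as \<open>\<eta>\<close> shrinks.
  Monotonicity alone gives this, with no measurability of \<open>f\<close>.\<close>

lemma nn_integral_infinite_of_inverse_square:
  fixes f :: "real \<Rightarrow> ennreal"
  assumes "0 < \<delta>" "0 < c" and f: "\<And>x. 0 < x \<Longrightarrow> x < \<delta> \<Longrightarrow> ennreal (c / x\<^sup>2) \<le> f x"
  shows "(\<integral>\<^sup>+x. f x \<partial>lborel) = \<infinity>"
proof (rule ccontr)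
  assume "\<not> ?thesis"
  then obtain B where B: "0 \<le> B" "(\<integral>\<^sup>+x. f x \<partial>lborel) = ennreal B"
    by (metis ennreal_cases infinity_ennreal_def)
  \<comment> \<open>The first bound keeps the interval below \<open>\<delta>\<close>, the second
    makes its contribution at least \<open>B + 1\<close>.\<close>
  define \<eta> where "\<eta> = min (\<delta> / 2) (c / (4 * (B + 1)))"
  have \<eta>: "0 < \<eta>" "2 * \<eta> \<le> \<delta>" "\<eta> \<le> c / (4 * (B + 1))"
    using assms B by (auto simp: \<eta>_def)
  have "ennreal (B + 1) \<le> ennreal (c / (4 * \<eta>))"
    using \<eta> B by (intro ennreal_leI) (simp add: field_simps)
  also have "\<dots> = (\<integral>\<^sup>+x. ennreal (c / (4 * \<eta>\<^sup>2)) * indicator {\<eta><..<2 * \<eta>} x \<partial>lborel)"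
    using \<eta> assms by (simp add: nn_integral_cmult power2_eq_square flip: ennreal_mult)
  also have "\<dots> \<le> (\<integral>\<^sup>+x. f x \<partial>lborel)"
  proof (intro nn_integral_mono)
    fix x
    show "ennreal (c / (4 * \<eta>\<^sup>2)) * indicator {\<eta><..<2 * \<eta>} x \<le> f x"
    proof (cases "x \<in> {\<eta><..<2 * \<eta>}")
      case True
      have "x\<^sup>2 \<le> (2 * \<eta>)\<^sup>2"
        using True \<eta> by (intro power_mono) auto
      then have "c / (4 * \<eta>\<^sup>2) \<le> c / x\<^sup>2"
        using True \<eta> assms by (intro divide_left_mono) (auto simp: power_mult_distrib)
      then show ?thesis
        using f[of x] True \<eta> by (auto intro: order_trans ennreal_leI)
    qed simp
  qed
  finally show False
    using B by simp
qed

lemma nn_integral_lborel_pair: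
  fixes g :: "real \<times> real \<Rightarrow> ennreal"
  assumes "g \<in> borel_measurable borel"
  shows "(\<integral>\<^sup>+z. g z \<partial>lborel) = (\<integral>\<^sup>+x. \<integral>\<^sup>+y. g (x, y) \<partial>lborel \<partial>lborel)"
proof -
  have "g \<in> borel_measurable (lborel \<Otimes>\<^sub>M lborel)"
    using assms by (simp add: lborel_prod)
  from lborel.nn_integral_fst[OF this] show ?thesis
    by (simp add: lborel_prod)
qed

lemma tendsto_powr_difference_quotient:
  fixes T :: real
  assumes "0 < T"
  shows "((\<lambda>h. (T powr h - 1) / h) \<longlongrightarrow> ln T) (at 0)"
proof -
  have "((\<lambda>h. exp (h * ln T)) has_real_derivative ln T) (at 0)"
    by (auto intro!: derivative_eq_intros)
  then show ?thesis
    using assms by (simp add: DERIV_def powr_def)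
qed

section \<open>The setting and the integrand for real exponents\<close>

text \<open>The test function enters the estimates through its bound \<open>M\<close> and a square
  of half-width \<open>R\<close> containing its support. The normalisation \<open>1 \<le> R\<close>
  allows \<open>R powr e\<close> to be replaced by \<open>R\<close> whenever
  \<open>e \<le> 1\<close>.\<close>

locale flat_phase =
  fixes a b q :: nat and p :: real and \<phi> :: "real \<times> real \<Rightarrow> real" and R M :: real
  assumes ab: "a < b" and q: "1 \<le> q" "q \<le> b" "even q" and p: "p > 0"
    and cont: "continuous_on UNIV \<phi>" and nonneg: "\<And>z. 0 \<le> \<phi> z" and le_M: "\<And>z. \<phi> z \<le> M"
    and R: "1 \<le> R" and supp: "\<And>x y. \<phi> (x, y) \<noteq> 0 \<Longrightarrow> \<bar>x\<bar> \<le> R \<and> \<bar>y\<bar> \<le> R"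
    and pos: "\<phi> (0, 0) > 0"
begin

definition weight :: "real \<Rightarrow> real \<times> real \<Rightarrow> real" where
  "weight s z = \<bar>phase a b q p z\<bar> powr s * \<phi> z"

lemma measurable_\<phi> [measurable]: "\<phi> \<in> borel_measurable borel"
  using cont by (rule borel_measurable_continuous_onI)

lemma measurable_weight [measurable]: "weight s \<in> borel_measurable borel"
  unfolding weight_def[abs_def] by measurable

lemma weight_nonneg: "0 \<le> weight s z"
  by (simp add: weight_def nonneg)

lemma M_nonneg: "0 \<le> M"
  using nonneg le_M order_trans by blast

text \<open>The two terms cannot cancel: the phase is a monomial times
  \<open>y ^ q + flat_exp p x\<close>, which is nonnegative because \<open>q\<close> is
  even.\<close>

lemma abs_phase:
  "\<bar>phase a b q p (x, y)\<bar> = \<bar>x\<bar> ^ a * (\<bar>y\<bar> ^ b + \<bar>y\<bar> ^ (b - q) * flat_exp p x)"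
proof -
  have yb: "y ^ b = y ^ (b - q) * y ^ q" "\<bar>y\<bar> ^ b = \<bar>y\<bar> ^ (b - q) * y ^ q"
    using q by (simp_all flip: power_add add: power_even_abs)
       (metis le_add_diff_inverse2 power_add power_even_abs)
  have "0 \<le> y ^ q + flat_exp p x"
    using q flat_exp_nonneg by (simp add: zero_le_even_power)
  moreover have "phase a b q p (x, y) = x ^ a * y ^ (b - q) * (y ^ q + flat_exp p x)"
    by (simp add: phase_def yb algebra_simps)
  ultimately have "\<bar>phase a b q p (x, y)\<bar> = \<bar>x\<bar> ^ a * \<bar>y\<bar> ^ (b - q) * (y ^ q + flat_exp p x)"
    by (simp only: abs_mult power_abs abs_of_nonneg)
  then show ?thesis
    by (simp add: yb algebra_simps)
qed

section \<open>Upper bounds and the limit at the critical exponent\<close>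

text \<open>A monomial lower bound on the phase becomes an upper bound for its nonpositive powers.
  It is applied with \<open>m = b\<close> for small \<open>x\<close> and with
  \<open>m = b - q\<close>, using the flat term, for the other \<open>x\<close>.\<close>

lemma inner_bound:
  assumes s: "s \<le> 0" "-1 < real m * s" and "0 < c"
    and le: "\<And>y. y \<noteq> 0 \<Longrightarrow> c * \<bar>y\<bar> ^ m \<le> \<bar>phase a b q p (x, y)\<bar>"
  shows "(\<integral>\<^sup>+y. ennreal (weight s (x, y)) \<partial>lborel)
    \<le> ennreal (indicator {-R..R} x * (M * c powr s * (2 * R / (1 + real m * s))))"
proof -
  define C where "C = indicator {-R..R} x * M * c powr s"
  have C: "0 \<le> C" by (simp add: C_def M_nonneg)
  have "(\<integral>\<^sup>+y. ennreal (weight s (x, y)) \<partial>lborel)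
    \<le> (\<integral>\<^sup>+y. ennreal C * ennreal (indicator {-R..R} y * \<bar>y\<bar> powr (real m * s)) \<partial>lborel)"
  proof (rule nn_integral_mono_AE)
    show "AE y in lborel. ennreal (weight s (x, y))
        \<le> ennreal C * ennreal (indicator {-R..R} y * \<bar>y\<bar> powr (real m * s))"
      using AE_lborel_singleton[of 0]
    proof eventually_elim
      case (elim y)
      show ?case
      proof (cases "\<phi> (x, y) = 0")
        case True
        then show ?thesis by (simp add: weight_def)
      next
        case False
        have "\<bar>phase a b q p (x, y)\<bar> powr s \<le> (c * \<bar>y\<bar> ^ m) powr s"
          using le[OF elim] \<open>0 < c\<close> elim s by (intro powr_mono2') auto
        also have "\<dots> = c powr s * \<bar>y\<bar> powr (real m * s)"
          using \<open>0 < c\<close> elim by (simp add: powr_mult powr_powr flip: powr_realpow)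
        finally have "weight s (x, y) \<le> c powr s * \<bar>y\<bar> powr (real m * s) * M"
          unfolding weight_def by (intro mult_mono) (auto simp: le_M nonneg)
        also have "\<dots> = C * (indicator {-R..R} y * \<bar>y\<bar> powr (real m * s))"
          using supp[OF False] by (simp add: C_def abs_le_iff)
        finally show ?thesis
          using C by (simp add: ennreal_leI flip: ennreal_mult)
      qed
    qed
  qed
  also have "\<dots> = ennreal (C * (2 * R powr (1 + real m * s) / (1 + real m * s)))"
    using s R C nn_integral_abs_powr[of "real m * s" R]
    by (subst nn_integral_cmult) (simp_all add: add.commute flip: ennreal_mult)
  also have "\<dots> \<le> ennreal (C * (2 * R / (1 + real m * s)))"
  proof -
    have "R powr (1 + real m * s) \<le> R powr 1"
      using R s by (intro powr_mono) (auto simp: mult_nonneg_nonpos)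
    then show ?thesis
      using R s C by (intro ennreal_leI mult_left_mono divide_right_mono) auto
  qed
  finally show ?thesis by (simp add: C_def mult_ac)
qed

text \<open>Split at \<open>\<bar>x\<bar> = \<delta>\<close>. Inside, dropping the flat term costs
  \<open>1 / (1 + b * s)\<close>, but integration over \<open>x\<close> gains
  \<open>\<delta> powr (1 / b)\<close>. Outside, keeping only the flat term, bounded below by its
  value at \<open>\<delta>\<close>, gives a bound uniform in \<open>s\<close>.\<close>

lemma nn_integral_weight_le:
  assumes s: "- 1 / real b < s" "s < 0" and \<delta>: "0 < \<delta>" "\<delta> \<le> 1"
  shows "(\<integral>\<^sup>+z. ennreal (weight s z) \<partial>lborel)
    \<le> ennreal (4 * real b * R * M * \<delta> powr (1 / real b) / (1 + real b * s) + 4 * (real b)\<^sup>2 * R\<^sup>2 * M / flat_exp p \<delta>)"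
proof -
  have b: "real b \<ge> 1" using ab by simp
  have bs: "0 < 1 + real b * s"
    using s b by (simp add: field_simps)
  have "real a + 1 \<le> real b" using ab by linarith
  \<comment> \<open>Since \<open>a\<close> and \<open>b - q\<close> are at most
    \<open>b - 1\<close>, the exponents \<open>a * s\<close> and \<open>(b - q) * s\<close> stay at
    distance at least \<open>1 / b\<close> from the critical exponent -1.\<close>
  have as: "1 / real b \<le> 1 + real a * s" "real a * s \<le> 0"
  proof -
    have "real a * (1 / real b) \<ge> real a * (- s)"
      using s by (intro mult_left_mono) auto
    moreover have "real a * (1 / real b) \<le> (real b - 1) * (1 / real b)"
      using ab b by (intro mult_right_mono) auto
    ultimately show "1 / real b \<le> 1 + real a * s" using b by (simp add: field_simps)
    show "real a * s \<le> 0" using s by (simp add: mult_nonneg_nonpos)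
  qed
  have qs: "1 / real b \<le> 1 + real (b - q) * s"
  proof -
    have "real (b - q) * (1 / real b) \<ge> real (b - q) * (- s)"
      using s by (intro mult_left_mono) auto
    moreover have "real (b - q) * (1 / real b) \<le> (real b - 1) * (1 / real b)"
      using q b by (intro mult_right_mono) auto
    ultimately show "1 / real b \<le> 1 + real (b - q) * s" using b by (simp add: field_simps)
  qed
  have b0: "0 < 1 / real b" using b by simp
  have "1 / real b \<le> 1" using b by simp
  then have s1: "-1 \<le> s" using s by simp
  \<comment> \<open>\<open>K\<close> blows up as \<open>s\<close> tends to \<open>- 1 / b\<close>;
    \<open>L\<close> is independent of \<open>s\<close>.\<close>
  define K where "K = M * (2 * R / (1 + real b * s))"
  define L where "L = M * (2 * R * real b / flat_exp p \<delta>)"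
  have KL: "0 \<le> K" "0 \<le> L"
    using M_nonneg R bs flat_exp_nonneg by (auto simp: K_def L_def)
  define J where "J = (\<lambda>r x. indicator {-r..r} x * \<bar>x\<bar> powr (real a * s))"
  have J0: "0 \<le> J r x" for r x by (simp add: J_def)
  have J_meas [measurable]: "J r \<in> borel_measurable borel" for r
    unfolding J_def by measurable
  have "(\<integral>\<^sup>+z. ennreal (weight s z) \<partial>lborel)
    = (\<integral>\<^sup>+x. \<integral>\<^sup>+y. ennreal (weight s (x, y)) \<partial>lborel \<partial>lborel)"
    by (rule nn_integral_lborel_pair) measurable
  also have "\<dots> \<le> (\<integral>\<^sup>+x. (ennreal K * ennreal (J \<delta> x) + ennreal L * ennreal (J R x)) \<partial>lborel)"
  proof (rule nn_integral_mono_AE)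
    show "AE x in lborel. (\<integral>\<^sup>+y. ennreal (weight s (x, y)) \<partial>lborel)
        \<le> ennreal K * ennreal (J \<delta> x) + ennreal L * ennreal (J R x)"
      using AE_lborel_singleton[of 0]
    proof eventually_elim
      case (elim x)
      have xa: "(\<bar>x\<bar> ^ a) powr s = \<bar>x\<bar> powr (real a * s)"
        using elim by (simp add: powr_powr flip: powr_realpow)
      show ?case
      proof (cases "\<bar>x\<bar> \<le> \<delta>")
        case True
        have "(\<integral>\<^sup>+y. ennreal (weight s (x, y)) \<partial>lborel)
          \<le> ennreal (indicator {-R..R} x * (M * (\<bar>x\<bar> ^ a) powr s * (2 * R / (1 + real b * s))))"
          by (rule inner_bound)
            (use s bs elim flat_exp_nonneg in \<open>auto simp: abs_phase intro!: mult_left_mono\<close>)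
        also have "\<dots> = ennreal (K * J \<delta> x)"
          using True \<delta> R by (simp add: K_def J_def xa abs_le_iff mult_ac)
        also have "\<dots> \<le> ennreal (K * J \<delta> x + L * J R x)"
          using KL J0 by (intro ennreal_leI) simp
        also have "\<dots> = ennreal K * ennreal (J \<delta> x) + ennreal L * ennreal (J R x)"
          using KL J0 by (simp add: ennreal_mult)
        finally show ?thesis .
      next
        case False
        have e: "0 < flat_exp p \<delta>" using \<delta> by (simp add: flat_exp_pos)
        have "(\<integral>\<^sup>+y. ennreal (weight s (x, y)) \<partial>lborel)
          \<le> ennreal (indicator {-R..R} x *
              (M * (\<bar>x\<bar> ^ a * flat_exp p \<delta>) powr s * (2 * R / (1 + real (b - q) * s))))"
        proof (rule inner_bound)
          fix y :: real
          have "\<bar>y\<bar> ^ (b - q) * flat_exp p \<delta> \<le> \<bar>y\<bar> ^ b + \<bar>y\<bar> ^ (b - q) * flat_exp p x"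
            using mult_left_mono[OF flat_exp_mono[of \<delta> x p], of "\<bar>y\<bar> ^ (b - q)"] False \<delta> p
            by (simp add: add_increasing)
          from mult_left_mono[OF this, of "\<bar>x\<bar> ^ a"]
          show "\<bar>x\<bar> ^ a * flat_exp p \<delta> * \<bar>y\<bar> ^ (b - q) \<le> \<bar>phase a b q p (x, y)\<bar>"
            by (simp add: abs_phase mult_ac)
        qed (use s qs b0 elim e in auto)
        also have "\<dots> \<le> ennreal (L * J R x)"
        proof (rule ennreal_leI)
          \<comment> \<open>As the base is at most 1 and \<open>s\<close> is at least -1, the power
            can be bounded independently of \<open>s\<close>.\<close>
          have "flat_exp p \<delta> powr s \<le> flat_exp p \<delta> powr (- 1)"
            using e s1 flat_exp_le_1 by (intro powr_mono') auto
          then have 1: "flat_exp p \<delta> powr s \<le> 1 / flat_exp p \<delta>"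
            using e by (simp add: powr_minus field_simps)
          have "2 * R / (1 + real (b - q) * s) \<le> 2 * R / (1 / real b)"
            using qs b0 less_le_trans[OF b0 qs] R by (intro divide_left_mono mult_pos_pos) simp_all
          then have 2: "2 * R / (1 + real (b - q) * s) \<le> 2 * R * real b" by simp
          have "indicator {-R..R} x * (M * \<bar>x\<bar> powr (real a * s) *
              (flat_exp p \<delta> powr s * (2 * R / (1 + real (b - q) * s))))
            \<le> indicator {-R..R} x * (M * \<bar>x\<bar> powr (real a * s) * (1 / flat_exp p \<delta> * (2 * R * real b)))"
            using 1 2 M_nonneg R e less_le_trans[OF b0 qs]
            by (intro mult_left_mono mult_mono) (auto intro!: mult_nonneg_nonneg divide_nonneg_pos)
          then show "indicator {-R..R} x * (M * (\<bar>x\<bar> ^ a * flat_exp p \<delta>) powr s *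
              (2 * R / (1 + real (b - q) * s))) \<le> L * J R x"
            using e by (simp add: L_def J_def xa powr_mult mult_ac)
        qed
        also have "\<dots> \<le> ennreal (K * J \<delta> x + L * J R x)"
          using KL J0 by (intro ennreal_leI) simp
        also have "\<dots> = ennreal K * ennreal (J \<delta> x) + ennreal L * ennreal (J R x)"
          using KL J0 by (simp add: ennreal_mult)
        finally show ?thesis .
      qed
    qed
  qed
  also have "\<dots> = ennreal (K * (2 * \<delta> powr (1 + real a * s) / (1 + real a * s))
      + L * (2 * R powr (1 + real a * s) / (1 + real a * s)))"
  proof -
    have "(\<integral>\<^sup>+x. ennreal (J r x) \<partial>lborel) = ennreal (2 * r powr (1 + real a * s) / (1 + real a * s))"
      if "0 \<le> r" for r
      unfolding J_def using nn_integral_abs_powr[of "real a * s" r] that as b0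
      by (simp add: add.commute)
    then show ?thesis
      using KL \<delta> R less_le_trans[OF b0 as(1)]
      by (simp add: nn_integral_add nn_integral_cmult flip: ennreal_mult ennreal_plus)
  qed
  also have "\<dots> \<le> ennreal (K * (2 * \<delta> powr (1 / real b) / (1 / real b)) + L * (2 * R / (1 / real b)))"
  proof -
    have "2 * \<delta> powr (1 + real a * s) \<le> 2 * \<delta> powr (1 / real b)"
      using \<delta> as by (simp add: powr_mono')
    then have "2 * \<delta> powr (1 + real a * s) / (1 + real a * s) \<le> 2 * \<delta> powr (1 / real b) / (1 / real b)"
      using as b0 by (intro frac_le) auto
    moreover have "R powr (1 + real a * s) \<le> R powr 1"
      using R as by (intro powr_mono) auto
    then have "2 * R powr (1 + real a * s) / (1 + real a * s) \<le> 2 * R / (1 / real b)"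
      using R as b0 by (intro frac_le) auto
    ultimately show ?thesis
      using KL by (intro ennreal_leI add_mono mult_left_mono)
  qed
  also have "\<dots> = ennreal (4 * real b * R * M * \<delta> powr (1 / real b) / (1 + real b * s) + 4 * (real b)\<^sup>2 * R\<^sup>2 * M / flat_exp p \<delta>)"
    by (simp add: K_def L_def power2_eq_square mult_ac)
  finally show ?thesis .
qed

lemma integrable_weight:
  assumes "- 1 / real b < s" "s < 0"
  shows "integrable lborel (weight s)"
proof (rule integrableI_nonneg)
  show "(\<integral>\<^sup>+z. ennreal (weight s z) \<partial>lborel) < \<infinity>"
    using nn_integral_weight_le[OF assms, of 1] by (simp add: le_less_trans)
qed (auto simp: weight_nonneg)

lemma integral_weight_le:
  assumes s: "- 1 / real b < s" "s < 0" and \<delta>: "0 < \<delta>" "\<delta> \<le> 1"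
  shows "(\<integral>z. weight s z \<partial>lborel)
    \<le> 4 * real b * R * M * \<delta> powr (1 / real b) / (1 + real b * s) + 4 * (real b)\<^sup>2 * R\<^sup>2 * M / flat_exp p \<delta>"
proof (rule integral_real_bounded)
  show "0 \<le> 4 * real b * R * M * \<delta> powr (1 / real b) / (1 + real b * s) + 4 * (real b)\<^sup>2 * R\<^sup>2 * M / flat_exp p \<delta>"
  proof -
    have "0 \<le> 1 + real b * s" using s ab by (simp add: field_simps)
    then have "0 \<le> 4 * real b * R * M * \<delta> powr (1 / real b) / (1 + real b * s)"
      using R M_nonneg by (intro divide_nonneg_nonneg mult_nonneg_nonneg) auto
    moreover have "0 \<le> 4 * (real b)\<^sup>2 * R\<^sup>2 * M / flat_exp p \<delta>"
      using R M_nonneg flat_exp_nonneg by (intro divide_nonneg_nonneg mult_nonneg_nonneg) auto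
    ultimately show ?thesis by simp
  qed
qed (rule nn_integral_weight_le[OF assms])

text \<open>After multiplication by \<open>s + 1 / b\<close>, the first term of
  \<open>integral_weight_le\<close> is a constant times \<open>\<delta> powr (1 / b)\<close>, and
  the second vanishes in the limit for fixed \<open>\<delta>\<close>. So \<open>\<delta>\<close> is
  chosen first, then \<open>s\<close>.\<close>

lemma tendsto_integral_weight:
  "((\<lambda>s. (s - (- 1 / real b)) * (\<integral>z. weight s z \<partial>lborel)) \<longlongrightarrow> 0) (at_right (- 1 / real b))"
proof (rule tendstoI)
  fix e :: real assume e: "0 < e"
  define c where "c = - 1 / real b"
  have b: "real b \<ge> 1" "c < 0" using ab by (auto simp: c_def)
  define C where "C = 4 * R * M"
  have C: "0 \<le> C" using R M_nonneg by (simp add: C_def)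
  \<comment> \<open>Chosen so that \<open>C * \<delta> powr (1 / b) \<le> e / 2\<close>;
    \<open>C + 1\<close> avoids division by zero.\<close>
  define \<delta> where "\<delta> = min 1 ((e / (2 * (C + 1))) powr real b)"
  have \<delta>: "0 < \<delta>" "\<delta> \<le> 1" using e C by (auto simp: \<delta>_def)
  have "\<delta> powr (1 / real b) \<le> ((e / (2 * (C + 1))) powr real b) powr (1 / real b)"
    using \<delta> by (intro powr_mono2) (auto simp: \<delta>_def)
  also have "\<dots> = e / (2 * (C + 1))"
    using e C b by (simp add: powr_powr)
  finally have "C * \<delta> powr (1 / real b) \<le> C * (e / (2 * (C + 1)))"
    using C by (intro mult_left_mono)
  also have "\<dots> \<le> e / 2"
    using C e by (simp add: field_simps)
  finally have 1: "C * \<delta> powr (1 / real b) \<le> e / 2" .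
  define D where "D = 4 * (real b)\<^sup>2 * R\<^sup>2 * M / flat_exp p \<delta>"
  have "((\<lambda>s. (s - c) * D) \<longlongrightarrow> (c - c) * D) (at_right c)"
    by (intro tendsto_intros)
  then have "\<forall>\<^sub>F s in at_right c. (s - c) * D < e / 2"
    using e by (intro order_tendstoD) auto
  moreover have "\<forall>\<^sub>F s in at_right c. s \<in> {c<..<0}"
    using b by (intro eventually_at_right_real)
  ultimately show "\<forall>\<^sub>F s in at_right (- 1 / real b).
      dist ((s - (- 1 / real b)) * (\<integral>z. weight s z \<partial>lborel)) 0 < e"
    unfolding c_def[symmetric]
  proof eventually_elim
    case (elim s)
    have bs: "1 + real b * s = real b * (s - c)" using b by (simp add: c_def field_simps)
    have Z0: "0 \<le> (\<integral>z. weight s z \<partial>lborel)"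
      by (simp add: weight_nonneg)
    have "(s - c) * (\<integral>z. weight s z \<partial>lborel)
      \<le> (s - c) * (4 * real b * R * M * \<delta> powr (1 / real b) / (1 + real b * s) + D)"
      unfolding D_def using elim \<delta> by (intro mult_left_mono integral_weight_le) (auto simp: c_def)
    also have "\<dots> = C * \<delta> powr (1 / real b) + (s - c) * D"
    proof -
      have "d * (4 * real b * R * M * w / (real b * d) + D) = C * w + d * D" if "d \<noteq> 0" for d w
        using that b by (simp add: C_def field_simps)
      then show ?thesis using elim unfolding bs by simp
    qed
    also have "\<dots> < e"
      using 1 elim by simp
    finally show ?case
      using Z0 elim by (simp add: dist_real_def)
  qed
qed

section \<open>Divergence from the region close to the x-axis\<close>

text \<open>In this region \<open>y ^ q < flat_exp p x\<close>, so the phase is at most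
  \<open>2 * x ^ a * y ^ (b - q) * flat_exp p x\<close>.\<close>

lemma phase_near_axis:
  assumes x: "0 < x" "x \<le> 1" "2 \<le> 1 / x powr p" and y: "0 < y" "y < exp (- (1 / x powr p) / q)"
  defines "T \<equiv> \<bar>phase a b q p (x, y)\<bar>"
  shows "0 < T" "exp ((1 / x powr p) / q) / 2 \<le> T powr (- 1 / real b)"
    "(1 / x powr p) / 2 \<le> - ln T"
proof -
  define v where "v = 1 / x powr p"
  have v: "2 \<le> v" using x by (simp add: v_def)
  have e: "flat_exp p x = exp (- v)"
    using x by (simp add: flat_exp_def v_def)
  have b: "real b \<ge> 1" "real q \<ge> 1" "real q \<le> real b" using ab q by auto
  have T: "T = x ^ a * (y ^ b + y ^ (b - q) * exp (- v))"
    using x y unfolding T_def abs_phase e by simp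
  show T0: "0 < T"
    unfolding T using x y by (intro mult_pos_pos add_pos_pos) auto
  have "y ^ q \<le> exp (- v / q) ^ q"
    using y by (intro power_mono) (auto simp: v_def)
  also have "\<dots> = exp (- v)"
    using b by (simp flip: exp_of_nat_mult)
  finally have "y ^ (b - q) * y ^ q \<le> y ^ (b - q) * exp (- v)"
    using y by (intro mult_left_mono) auto
  moreover have "y ^ b = y ^ (b - q) * y ^ q"
    using q by (simp flip: power_add)
  moreover have "y ^ (b - q) * exp (- v) \<le> exp (- v / q) ^ (b - q) * exp (- v)"
    using y by (intro mult_right_mono power_mono) (auto simp: v_def)
  \<comment> \<open>At the edge \<open>y = exp (- v / q)\<close> both terms of the phase have the
    same size, \<open>exp (- (b * v / q))\<close> up to the factor \<open>x ^ a\<close>.\<close>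
  moreover have "exp (- v / q) ^ (b - q) * exp (- v) = exp (- (b * v / q))"
    using q b by (simp flip: exp_of_nat_mult exp_add add: field_simps of_nat_diff)
  ultimately have "y ^ b + y ^ (b - q) * exp (- v) \<le> 2 * exp (- (b * v / q))"
    by linarith
  moreover have "x ^ a \<le> 1" using x by (simp add: power_le_one)
  ultimately have "T \<le> 1 * (2 * exp (- (b * v / q)))"
    unfolding T using x y by (intro mult_mono) auto
  then have T_le: "T \<le> 2 * exp (- (b * v / q))" by simp
  then have "ln T \<le> ln (2 * exp (- (b * v / q)))"
    using T0 by (subst ln_le_cancel_iff) auto
  then have ln_le: "ln T \<le> ln 2 - b * v / q"
    by (simp add: ln_mult)
  have ln2: "ln 2 \<le> (1::real)"
    using ln_le_minus_one[of 2] by simp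
  have "v \<le> b * v / q"
    using b v by (simp add: field_simps)
  \<comment> \<open>Here \<open>- ln T \<ge> v - ln 2 \<ge> v - 1\<close>, and
    \<open>2 \<le> v\<close> makes this at least \<open>v / 2\<close>.\<close>
  then show "(1 / x powr p) / 2 \<le> - ln T"
    unfolding v_def[symmetric] using ln_le ln2 v by linarith
  \<comment> \<open>The exponent \<open>- 1 / b\<close> turns \<open>exp (- (b * v / q))\<close>
    into \<open>exp (v / q)\<close>, the reciprocal of the length of the range of
    \<open>y\<close>.\<close>
  have "v / q - ln 2 \<le> v / q - ln 2 / b"
    using b ln2 by (simp add: field_simps)
  also have "\<dots> = (- 1 / b) * (ln 2 - b * v / q)"
    using b by (simp add: field_simps)
  also have "\<dots> \<le> (- 1 / b) * ln T"
    using b by (intro mult_left_mono_neg ln_le) auto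
  finally have "exp (v / q - ln 2) \<le> exp ((- 1 / b) * ln T)"
    by simp
  then show "exp ((1 / x powr p) / q) / 2 \<le> T powr (- 1 / real b)"
    unfolding v_def[symmetric] using T0 by (simp add: powr_def exp_diff)
qed

text \<open>The range of \<open>y\<close> shrinks to 0 with \<open>x\<close>, so for small
  \<open>x\<close> the whole region lies where continuity keeps \<open>\<phi>\<close> above half its
  value at the origin.\<close>

lemma near_origin:
  obtains \<delta> c where "0 < \<delta>" "\<delta> \<le> 1" "0 < c"
    "\<And>x. 0 < x \<Longrightarrow> x < \<delta> \<Longrightarrow> 2 \<le> 1 / x powr p"
    "\<And>x y. 0 < x \<Longrightarrow> x < \<delta> \<Longrightarrow> 0 < y \<Longrightarrow> y < exp (- (1 / x powr p) / q) \<Longrightarrow> c \<le> \<phi> (x, y)"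
proof -
  define c where "c = \<phi> (0, 0) / 2"
  have c: "0 < c" using pos by (simp add: c_def)
  have "isCont \<phi> (0, 0)"
    using cont by (simp add: continuous_on_eq_continuous_at)
  then have "\<forall>\<^sub>F z in nhds (0, 0). c < \<phi> z"
    unfolding isCont_def tendsto_at_iff_tendsto_nhds
    using pos by (intro order_tendstoD(1)) (auto simp: c_def)
  then obtain d where d: "0 < d" "\<And>z. dist z (0, 0) < d \<Longrightarrow> c < \<phi> z"
    by (auto simp: eventually_nhds_metric)
  \<comment> \<open>A lower bound for \<open>1 / x powr p\<close>: 2 is what
    \<open>phase_near_axis\<close> asks for, and the other value forces
    \<open>y < d / 2\<close>.\<close>
  define N where "N = max 2 (real q * - ln (d / 2))"
  have N: "2 \<le> N" "real q * - ln (d / 2) \<le> N" by (auto simp: N_def)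
  define \<delta> where "\<delta> = min (min 1 (d / 2)) ((1 / N) powr (1 / p))"
  have large: "N \<le> 1 / x powr p" if "0 < x" "x < \<delta>" for x
  proof -
    have "x powr p \<le> ((1 / N) powr (1 / p)) powr p"
      using that p by (intro powr_mono2) (auto simp: \<delta>_def)
    also have "\<dots> = 1 / N"
      using p N by (simp add: powr_powr)
    finally show ?thesis
      using that N by (simp add: field_simps)
  qed
  show thesis
  proof (rule that[of \<delta> c])
    show "0 < \<delta>" "\<delta> \<le> 1" using d N by (auto simp: \<delta>_def)
    show "2 \<le> 1 / x powr p" if "0 < x" "x < \<delta>" for x
      using large[OF that] N by linarith
  next
    fix x y assume x: "0 < x" "x < \<delta>" and y: "0 < y" "y < exp (- (1 / x powr p) / q)"
    have "real q * - ln (d / 2) \<le> 1 / x powr p"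
      using large[OF x] N by linarith
    then have "- (1 / x powr p) / q \<le> ln (d / 2)"
      using q divide_right_mono[of "real q * - ln (d / 2)" "1 / x powr p" "real q"] by simp
    then have "exp (- (1 / x powr p) / q) \<le> exp (ln (d / 2))"
      by simp
    with y d have "\<bar>y\<bar> < d / 2" by simp
    moreover have "\<bar>x\<bar> < d / 2" using x by (simp add: \<delta>_def)
    moreover have "dist (x, y) (0, 0) \<le> \<bar>x\<bar> + \<bar>y\<bar>"
      using sqrt_sum_squares_le_sum_abs[of x y] by (simp add: dist_Pair_Pair)
    ultimately show "c \<le> \<phi> (x, y)"
      using d(2)[of "(x, y)"] by simp
  qed (rule c)
qed

lemma fdiff_weight:
  "fdiff k h (\<lambda>s. weight s z) t = \<bar>phase a b q p z\<bar> powr t * (\<bar>phase a b q p z\<bar> powr h - 1) ^ k * \<phi> z"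
  unfolding weight_def fdiff_mult_right fdiff_powr ..

text \<open>Fatou's lemma turns the bound on the differences into finiteness of the integral of
  \<open>\<bar>f\<bar> powr (- 1 / b) * (ln \<bar>f\<bar>) ^ k * \<phi>\<close>; evenness of \<open>k\<close> keeps the integrands nonnegative.\<close>

lemma fdiff_integral_weight_unbounded:
  assumes k: "even k" "2 \<le> p * real k" and "0 < h0"
    and bd: "\<And>h. 0 < h \<Longrightarrow> h \<le> h0 \<Longrightarrow>
      \<bar>fdiff k h (\<lambda>s. \<integral>z. weight s z \<partial>lborel) (- 1 / real b + h)\<bar> \<le> B * h ^ k"
  shows False
proof -
  define s0 where "s0 = - 1 / real b"
  have s0: "s0 < 0" using ab by (simp add: s0_def)
  \<comment> \<open>Keeps all sample points \<open>s0 + (j + 1) * h\<close> with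
    \<open>j \<le> k\<close> strictly negative, where \<open>integrable_weight\<close>
    applies.\<close>
  define h1 where "h1 = min h0 (- s0 / (real k + 2))"
  define h where "h = (\<lambda>n. h1 / real (Suc n))"
  have h1: "0 < h1" using \<open>0 < h0\<close> s0 by (simp add: h1_def divide_neg_pos)
  have h_pos: "0 < h n" for n using h1 by (simp add: h_def)
  have h_le: "h n \<le> h1" for n using h1 by (simp add: h_def field_simps)
  have "h \<longlonglongrightarrow> h1 * 0"
    unfolding h_def divide_inverse by (intro tendsto_intros LIMSEQ_inverse_real_of_nat)
  then have h_lim: "filterlim h (at 0) sequentially"
    using h_pos by (auto simp: filterlim_at less_imp_neq[symmetric] intro!: always_eventually)
  \<comment> \<open>Difference quotients based just to the right of \<open>s0\<close>. Where the
    phase is nonzero they converge to the formal \<open>k\<close>-th derivative of the integrand,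
    while their integrals stay below \<open>B\<close>.\<close>
  define F where "F = (\<lambda>n z. fdiff k (h n) (\<lambda>s. weight s z) (s0 + h n) / h n ^ k)"
  have F_eq: "F n z = \<bar>phase a b q p z\<bar> powr (s0 + h n) *
      ((\<bar>phase a b q p z\<bar> powr h n - 1) / h n) ^ k * \<phi> z" for n z
    by (simp add: F_def fdiff_weight power_divide)
  have F_nonneg: "0 \<le> F n z" for n z
    unfolding F_eq using k by (intro mult_nonneg_nonneg nonneg zero_le_even_power) auto
  have F_meas [measurable]: "F n \<in> borel_measurable borel" for n
    unfolding F_eq[abs_def] by measurable
  have F_int: "(\<integral>\<^sup>+z. ennreal (F n z) \<partial>lborel) \<le> ennreal B" for n
  proof -
    have "integrable lborel (weight (s0 + h n + real j * h n))" if "j \<le> k" for j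
    proof (rule integrable_weight)
      have "(1 + real j) * h n \<le> (1 + real k) * (- s0 / (real k + 2))"
        using that h_pos[of n] h_le[of n] s0 by (intro mult_mono) (auto simp: h1_def)
      also have "\<dots> < - s0"
        using s0 by (simp add: field_simps)
      finally show "s0 + h n + real j * h n < 0" by (simp add: algebra_simps)
      show "- 1 / real b < s0 + h n + real j * h n"
        using h_pos[of n] by (simp add: s0_def add_pos_nonneg)
    qed
    note int = integral_fdiff[where k = k and t = "s0 + h n" and h = "h n" and w = weight and M = lborel, OF this]
    have iF: "integrable lborel (F n)"
      unfolding F_def using int by simp
    have "(\<integral>z. F n z \<partial>lborel) = fdiff k (h n) (\<lambda>s. \<integral>z. weight s z \<partial>lborel) (s0 + h n) / h n ^ k"
      unfolding F_def using int by simp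
    also have "\<dots> \<le> B * h n ^ k / h n ^ k"
      using bd[of "h n"] h_pos[of n] h_le[of n]
      by (intro divide_right_mono) (auto simp: s0_def h1_def)
    also have "\<dots> = B" using h_pos[of n] by simp
    finally show ?thesis
      using nn_integral_eq_integral[OF iF] F_nonneg by (simp add: ennreal_leI)
  qed
  obtain \<delta> c where \<delta>: "0 < \<delta>" "\<delta> \<le> 1" and c: "0 < c"
    and v2: "\<And>x. 0 < x \<Longrightarrow> x < \<delta> \<Longrightarrow> 2 \<le> 1 / x powr p"
    and \<phi>_ge: "\<And>x y. 0 < x \<Longrightarrow> x < \<delta> \<Longrightarrow> 0 < y \<Longrightarrow> y < exp (- (1 / x powr p) / q) \<Longrightarrow> c \<le> \<phi> (x, y)"
    by (rule near_origin) blast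
  \<comment> \<open>One factor 2 comes from the bound on \<open>T powr s0\<close>, the other
    \<open>k\<close> from \<open>(v / 2) ^ k\<close>.\<close>
  define c' where "c' = c / 2 ^ Suc k"
  have c': "0 < c'" using c by (simp add: c'_def)
  have lower: "ennreal (exp ((1 / x powr p) / q) * (c' / x\<^sup>2)) \<le> liminf (\<lambda>n. ennreal (F n (x, y)))"
    if x: "0 < x" "x < \<delta>" and y: "0 < y" "y < exp (- (1 / x powr p) / q)" for x y
  proof -
    define T where "T = \<bar>phase a b q p (x, y)\<bar>"
    define v where "v = 1 / x powr p"
    note T = phase_near_axis[OF x(1) less_imp_le[OF less_le_trans[OF x(2) \<delta>(2)]] v2[OF x] y,
      folded T_def, folded v_def s0_def]
    have v: "2 \<le> v" using v2[OF x] by (simp add: v_def)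
    have h_0: "h \<longlonglongrightarrow> 0" using h_lim by (simp add: filterlim_at)
    have "(\<lambda>n. F n (x, y)) \<longlonglongrightarrow> T powr (s0 + 0) * ln T ^ k * \<phi> (x, y)"
      unfolding F_eq T_def[symmetric]
      using T(1) by (intro tendsto_intros h_0
          filterlim_compose[OF tendsto_powr_difference_quotient h_lim]) auto
    then have "(\<lambda>n. ennreal (F n (x, y))) \<longlonglongrightarrow> ennreal (T powr s0 * ln T ^ k * \<phi> (x, y))"
      by (intro tendsto_ennrealI) simp
    then have lim: "liminf (\<lambda>n. ennreal (F n (x, y))) = ennreal (T powr s0 * ln T ^ k * \<phi> (x, y))"
      by (intro lim_imp_Liminf) auto
    \<comment> \<open>The order \<open>k\<close> was taken large enough that \<open>v ^ k\<close>,
      which is \<open>x powr - (p * k)\<close>, dominates the nonintegrable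
      \<open>1 / x\<^sup>2\<close>.\<close>
    have "1 / x\<^sup>2 = x powr - 2"
      using x by (simp add: powr_minus powr_numeral field_simps)
    also have "\<dots> \<le> x powr - (p * real k)"
      using x \<delta> k by (intro powr_mono') auto
    also have "\<dots> = v ^ k"
    proof -
      have "v = x powr - p" by (simp add: v_def powr_minus_divide)
      then show ?thesis using x by (simp add: powr_powr flip: powr_realpow)
    qed
    finally have "1 / x\<^sup>2 \<le> v ^ k" .
    moreover have "(v / 2) ^ k \<le> (- ln T) ^ k"
      using T(3) v by (intro power_mono) auto
    ultimately have "1 / x\<^sup>2 \<le> ln T ^ k * 2 ^ k"
      using k by (simp add: power_divide field_simps)
    then have ln: "1 / x\<^sup>2 / 2 ^ k \<le> ln T ^ k"
      by (simp only: pos_divide_le_eq zero_less_power zero_less_numeral)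
    have "(exp (v / q) / 2) * (1 / x\<^sup>2 / 2 ^ k) * c \<le> T powr s0 * ln T ^ k * \<phi> (x, y)"
      using T(2) ln \<phi>_ge[OF x y] c nonneg k
      by (intro mult_mono mult_nonneg_nonneg zero_le_even_power) auto
    then show ?thesis
      unfolding lim v_def[symmetric] by (intro ennreal_leI) (simp add: c'_def mult_ac)
  qed
  have inf: "(\<integral>\<^sup>+x. \<integral>\<^sup>+y. liminf (\<lambda>n. ennreal (F n (x, y))) \<partial>lborel \<partial>lborel) = \<infinity>"
  proof (rule nn_integral_infinite_of_inverse_square[OF \<delta>(1) c'])
    fix x :: real assume x: "0 < x" "x < \<delta>"
    define E where "E = exp (- (1 / x powr p) / q)"
    have E: "0 < E" by (simp add: E_def)
    \<comment> \<open>The length \<open>E\<close> of the range of \<open>y\<close> cancels the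
      growth \<open>exp (v / q)\<close> exactly, leaving only the logarithmic factor.\<close>
    have "c' / x\<^sup>2 = (exp ((1 / x powr p) / q) * (c' / x\<^sup>2)) * E"
      by (simp add: E_def exp_minus field_simps flip: exp_add)
    then have "ennreal (c' / x\<^sup>2) = (\<integral>\<^sup>+y. ennreal (exp ((1 / x powr p) / q) * (c' / x\<^sup>2)) * indicator {0<..<E} y \<partial>lborel)"
      using c' E by (simp add: nn_integral_cmult_indicator flip: ennreal_mult)
    also have "\<dots> \<le> (\<integral>\<^sup>+y. liminf (\<lambda>n. ennreal (F n (x, y))) \<partial>lborel)"
    proof (rule nn_integral_mono)
      fix y
      show "ennreal (exp ((1 / x powr p) / q) * (c' / x\<^sup>2)) * indicator {0<..<E} y
        \<le> liminf (\<lambda>n. ennreal (F n (x, y)))"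
        using lower[OF x, of y] by (auto simp: E_def indicator_def)
    qed
    finally show "ennreal (c' / x\<^sup>2) \<le> (\<integral>\<^sup>+y. liminf (\<lambda>n. ennreal (F n (x, y))) \<partial>lborel)" .
  qed
  have "(\<integral>\<^sup>+x. \<integral>\<^sup>+y. liminf (\<lambda>n. ennreal (F n (x, y))) \<partial>lborel \<partial>lborel)
      = (\<integral>\<^sup>+z. liminf (\<lambda>n. ennreal (F n z)) \<partial>lborel)"
    by (rule nn_integral_lborel_pair[symmetric]) measurable
  also have "\<dots> \<le> liminf (\<lambda>n. \<integral>\<^sup>+z. ennreal (F n z) \<partial>lborel)"
    by (rule nn_integral_liminf) measurable
  also have "\<dots> \<le> ennreal B"
    by (rule Liminf_le) (simp_all add: F_int)
  finally show False using inf by (simp add: top_unique)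
qed

section \<open>Return to the complex zeta function\<close>

lemma local_zeta_of_real:
  "local_zeta (phase a b q p) \<phi> (of_real s) = of_real (\<integral>z. weight s z \<partial>lborel)"
proof -
  have "local_zeta (phase a b q p) \<phi> (of_real s) = (\<integral>z. complex_of_real (weight s z) \<partial>lborel)"
    unfolding local_zeta_def weight_def by (simp add: powr_of_real)
  then show ?thesis by simp
qed

lemma not_meromorphically_continuable:
  assumes V: "of_real (- 1 / real b) \<in> V"
  shows "\<not> meromorphically_continuable (local_zeta (phase a b q p) \<phi>) {s. Re s > - 1 / real b} V"
proof
  define c where "c = - 1 / real b"
  define Z where "Z = (\<lambda>s. \<integral>z. weight s z \<partial>lborel)"
  assume "meromorphically_continuable (local_zeta (phase a b q p) \<phi>) {s. Re s > - 1 / real b} V"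
  then obtain g where g: "g meromorphic_on V \<union> {s. Re s > c}"
    and eq: "\<And>s. Re s > c \<Longrightarrow> g s = local_zeta (phase a b q p) \<phi> s"
    by (auto simp: meromorphically_continuable_def c_def)
  have gZ: "g (of_real s) = of_real (Z s)" if "c < s" for s
    using eq[of "of_real s"] that by (simp add: local_zeta_of_real Z_def)
  have "g meromorphic_on {of_real c}"
    using g V by (auto simp: c_def intro: meromorphic_on_subset)
  moreover have "((\<lambda>s. of_real (s - c) * g (of_real s)) \<longlongrightarrow> 0) (at_right c)"
  proof (rule Lim_transform_eventually)
    show "((\<lambda>s. complex_of_real ((s - c) * Z s)) \<longlongrightarrow> 0) (at_right c)"
      using tendsto_of_real[OF tendsto_integral_weight, where 'a = complex]
      by (simp add: c_def Z_def)
    show "\<forall>\<^sub>F s in at_right c. complex_of_real ((s - c) * Z s) = of_real (s - c) * g (of_real s)"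
      using eventually_at_right_less[of c] by eventually_elim (simp add: gZ)
  qed
  ultimately obtain G r where r: "0 < r" and G: "G holomorphic_on ball (of_real c) r"
    and Gg: "\<And>s. s \<in> ball (of_real c) r - {of_real c} \<Longrightarrow> G s = g s"
    by (rule meromorphic_removable_along_ray) blast
  \<comment> \<open>The smallest choice of this form that is even and satisfies
    \<open>2 \<le> p * k\<close>.\<close>
  define k where "k = 2 * nat \<lceil>1 / p\<rceil>"
  have "1 / p \<le> real (nat \<lceil>1 / p\<rceil>)" by (rule real_nat_ceiling_ge)
  then have k: "even k" "2 \<le> p * real k"
    using p mult_left_mono[of "1 / p" _ p] by (fastforce simp: k_def)+
  obtain B where B: "\<And>h. 0 < h \<Longrightarrow> (real k + 1) * h \<le> r / 2 \<Longrightarrow>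
      \<bar>fdiff k h (\<lambda>s. Re (G (of_real s))) (c + h)\<bar> \<le> B * h ^ k"
    using holomorphic_fdiff_bound[OF G r] by blast
  show False
  proof (rule fdiff_integral_weight_unbounded[OF k, of "r / 2 / (real k + 1)" B])
    fix h assume h: "0 < h" "h \<le> r / 2 / (real k + 1)"
    then have h': "(real k + 1) * h \<le> r / 2" by (simp add: field_simps)
    \<comment> \<open>All sample points lie strictly to the right of \<open>c\<close> and inside the
      ball, where \<open>G\<close>, \<open>g\<close> and the zeta integral agree.\<close>
    have "fdiff k h (\<lambda>s. Re (G (of_real s))) (c + h) = fdiff k h Z (c + h)"
    proof (rule fdiff_cong)
      fix j assume j: "j \<le> k"
      define s where "s = c + h + real j * h"
      have "(real j + 1) * h \<le> (real k + 1) * h"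
        using j h by (intro mult_right_mono) auto
      then have "h + real j * h \<le> r / 2"
        using h' by (simp add: algebra_simps)
      moreover have "0 \<le> real j * h" using h by simp
      ultimately have s: "c < s" "s < c + r"
        unfolding s_def using h r by linarith+
      have "dist (complex_of_real c) (of_real s) < r"
        using s by (simp only: dist_of_real dist_real_def)
      with s have "G (of_real s) = g (of_real s)"
        by (intro Gg) auto
      then show "Re (G (of_real (c + h + real j * h))) = Z (c + h + real j * h)"
        using gZ[OF s(1)] by (simp add: s_def)
    qed
    with B[OF h(1) h'] show "\<bar>fdiff k h (\<lambda>s. \<integral>z. weight s z \<partial>lborel) (- 1 / real b + h)\<bar> \<le> B * h ^ k"
      by (simp add: Z_def c_def)
  qed (use r in simp)
qed

end

theorem corollary2p2:
  fixes a b q :: nat and p :: real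
    and U :: "(real \<times> real) set" and \<phi> :: "real \<times> real \<Rightarrow> real"
  assumes "a < b" and "2 \<le> b" and "1 \<le> q" and "q \<le> b" and "even q"
    and "p > 0"
    and "open U" and "(0, 0) \<in> U"
    and "smooth_on UNIV \<phi>"
    and "compact (closure (support_on UNIV \<phi>))"
    and "closure (support_on UNIV \<phi>) \<subseteq> U"
    and "\<phi> (0, 0) > 0"
    and "\<forall>z\<in>U. \<phi> z \<ge> 0"
  shows "\<forall>V. open V \<and> - 1 / of_nat b \<in> V \<longrightarrow>
    \<not> meromorphically_continuable (local_zeta (phase a b q p) \<phi>)
        {s. Re s > - 1 / real b} V"
proof -
  define K where "K = closure (support_on UNIV \<phi>)"
  have K: "z \<in> K" if "\<phi> z \<noteq> 0" for z
    using that closure_subset[of "support_on UNIV \<phi>"] by (auto simp: K_def support_on_def)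
  have cont: "continuous_on UNIV \<phi>"
    using assms(9) unfolding smooth_on_def by (metis Ck_on.simps(1))
  have "bounded K" using assms(10) by (simp add: K_def compact_imp_bounded)
  then obtain R where R: "\<And>z. z \<in> K \<Longrightarrow> norm z \<le> R" by (auto simp: bounded_iff)
  have "compact (\<phi> ` K)"
    using assms(10) cont by (intro compact_continuous_image)
      (auto simp: K_def intro: continuous_on_subset)
  then obtain M where M: "\<And>z. z \<in> K \<Longrightarrow> \<bar>\<phi> z\<bar> \<le> M"
    by (fastforce dest!: compact_imp_bounded simp: bounded_iff)
  \<comment> \<open>\<open>max 1\<close> secures the normalisation of \<open>R\<close>;
    \<open>max 0\<close> also covers points outside \<open>K\<close>, where \<open>\<phi>\<close> is
    0.\<close>
  interpret flat_phase a b q p \<phi> "max 1 R" "max 0 M"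
  proof
    show "0 \<le> \<phi> z" for z
      using K[of z] assms(11,13) by (cases "\<phi> z = 0") (auto simp: K_def)
    show "\<phi> z \<le> max 0 M" for z
      using K[of z] M[of z] by (cases "\<phi> z = 0") auto
    show "\<bar>x\<bar> \<le> max 1 R \<and> \<bar>y\<bar> \<le> max 1 R" if "\<phi> (x, y) \<noteq> 0" for x y
      using R[OF K[OF that]] norm_fst_le[of x y] norm_snd_le[of y x] by auto
  qed (use assms cont in auto)
  show ?thesis
    using not_meromorphically_continuable by simp
qed

end
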